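(* Let $\mathcal S$ be nested as in the context, and let $p\in I$ and $S'\subseteq J$ be such that $|S'\setminus S_p|\le u-1$. If $p<m$ or $|S_m|<n-l$, then the conditions (U1) $S'\supseteq S_p$; (U2) $|S'\setminus S_{p-1}|\ge u$ if $p\ge 2$; (U3) $|S'|\ge u+1$; (U4) $S'\cap(S_{p+1}\setminus S_p)\ne\emptyset$ if $p\le m-1$ are together sufficient for the inequality $$\sum_{j\in S'}z_j+\bigl(u-|S'\setminus S_p|\bigr)\delta_p+\sum_{i=p+1}^m\bigl(|S'\setminus S_{i-1}|-|S'\setminus S_i|\bigr)\delta_i\le u$$ to define a facet of $\operatorname{conv}(X^{l,u})$.
   Context: Let $n,m$ be positive integers, $J=\{1,\dots,n\}$, $I=\{1,\dots,m\}$, and let $l,u$ be integers with $0\le l<u$ and $u\ge2$. The sets are nested: $S_1\subsetneq S_2\subsetneq\dots\subsetneq S_m\subsetneq J$, with $|S_1|\ge 2$ and $l\le n-|S_m|$; $\mathcal S=\{S_i\}_{i\in I}$. Define $$X^{l,u}=\Bigl\{(z,\delta)\in\{0,1\}^n\times\{0,1\}^m:\ \delta_i=\prod_{j\in S_i}(1-z_j)\ (i\in I),\ l\le\sum_{j\in J}z_j\le u\Bigr\}.$$ *)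

theory Defs
  imports "HOL-Analysis.Analysis"
begin

text \<open>
  The ground set \<open>J\<close> is the universe of the finite type \<open>'n\<close>, whose cardinality is the number \<open>n\<close>.
  The family \<open>S 1, \<dots>, S m\<close> is indexed by natural numbers; \<open>S\<close> is irrelevant outside \<open>{1..m}\<close>.
  The coordinates of \<open>\<delta>\<close> are indexed by a finite type \<open>'m\<close>, and a bijection \<open>ix\<close> from \<open>{1..m}\<close> onto
  \<open>'m\<close> says which of them is the \<open>i\<close>-th one. Thus \<open>\<delta> $ ix i\<close> stands for \<open>\<delta>\<^sub>i\<close>.
\<close>

definition Xset ::
  "(nat \<Rightarrow> 'm::finite) \<Rightarrow> nat \<Rightarrow> (nat \<Rightarrow> 'n::finite set) \<Rightarrow> nat \<Rightarrow> nat \<Rightarrow> ((real^'n) \<times> (real^'m)) set"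
  where
  "Xset ix m S l u =
    {(z, \<delta>). (\<forall>j. z $ j \<in> {0, 1}) \<and> (\<forall>i\<in>{1..m}. \<delta> $ ix i \<in> {0, 1}) \<and>
       (\<forall>i\<in>{1..m}. \<delta> $ ix i = (\<Prod>j\<in>S i. 1 - z $ j)) \<and>
       real l \<le> (\<Sum>j\<in>UNIV. z $ j) \<and> (\<Sum>j\<in>UNIV. z $ j) \<le> real u}"

text \<open>The linear inequality \<open>f x \<le> b\<close> is valid for \<open>P\<close> and the face it induces is a facet of \<open>P\<close>.\<close>

definition defines_facet :: "('a::euclidean_space \<Rightarrow> real) \<Rightarrow> real \<Rightarrow> 'a set \<Rightarrow> bool" where
  "defines_facet f b P \<longleftrightarrow>
     linear f \<and> (\<forall>x\<in>P. f x \<le> b) \<and> {x \<in> P. f x = b} facet_of P"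

end

theory Submission
  imports Defs
begin

text \<open>
  By the definition of \<open>\<delta>\<close>, the elements of \<open>X\<close> are the vectors \<open>(\<chi>\<^sub>A, \<delta>(A))\<close> with
  \<open>l \<le> |A| \<le> u\<close>, and because the \<open>S i\<close> are nested, \<open>\<delta>(A)\<close> depends only on the level of \<open>A\<close>: the
  number \<open>k\<close> of members of the family that \<open>A\<close> misses, which are \<open>S 1, \<dots>, S k\<close>. At a point of level
  \<open>k\<close> the \<open>\<delta>\<close>-part of the inequality telescopes to \<open>0\<close> if \<open>k < p\<close>, and to \<open>u - |S' - S k|\<close> otherwise.
  In the first case the left-hand side is \<open>|A \<inter> S'| \<le> |A| \<le> u\<close>, in the second it is at most \<open>u\<close>
  because \<open>A\<close> misses \<open>S k\<close>. So the inequality is valid, and the tight points are given by the subsets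
  of \<open>S'\<close> of size \<open>u\<close> and level \<open>< p\<close>, and by the sets of level \<open>k \<ge> p\<close> that contain \<open>S' - S k\<close>.

  The tight points span a facet as soon as every equation \<open>\<alpha> z + \<beta> \<delta> = c\<close> that holds on them is a
  multiple of the given one (lemma \<open>facet_of_convex_hullI\<close>; the dimension of the hull itself need not
  be known). Exchanging elements between tight sets of level \<open>0\<close> shows that \<open>\<alpha>\<close> has a constant value
  \<open>a\<close> on \<open>S'\<close> and that \<open>c = a u\<close>; this uses \<open>|S'| > u\<close>. Adding an element of \<open>- S'\<close> to a tight set of
  level \<open>p\<close> shows that \<open>\<alpha>\<close> vanishes on \<open>- S'\<close>. Finally, there is a tight set of each level \<open>k\<close>, and it
  determines \<open>\<beta> 1 + \<dots> + \<beta> k\<close>, hence all of \<open>\<beta>\<close>.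
\<close>

section \<open>Facets from uniqueness of the supporting equation\<close>

text \<open>
  The affine hull of the tight points is an intersection of as many hyperplanes as its codimension.
  Uniqueness forces all of these hyperplanes to coincide, so the codimension is at most one. As \<open>y\<close>
  makes the face proper, its dimension is smaller than that of the hull, which leaves only one value
  for each of the two dimensions.
\<close>

lemma facet_of_convex_hullI:
  fixes X :: "'a::euclidean_space set"
  assumes valid: "\<And>x. x \<in> X \<Longrightarrow> N \<bullet> x \<le> b"
    and y: "y \<in> X" "N \<bullet> y < b"
    and unique: "\<And>v c. (\<And>x. x \<in> X \<Longrightarrow> N \<bullet> x = b \<Longrightarrow> v \<bullet> x = c) \<Longrightarrow> \<exists>t. v = t *\<^sub>R N \<and> c = t * b"
  shows "\<forall>x\<in>convex hull X. N \<bullet> x \<le> b"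
    and "{x \<in> convex hull X. N \<bullet> x = b} facet_of convex hull X"
proof -
  define P where "P = convex hull X"
  define T where "T = {x \<in> X. N \<bullet> x = b}"
  define F where "F = {x \<in> P. N \<bullet> x = b}"
  have "convex hull X \<subseteq> {x. N \<bullet> x \<le> b}"
    using valid by (intro hull_minimal) (auto simp: convex_halfspace_le)
  then show le: "\<forall>x\<in>convex hull X. N \<bullet> x \<le> b" by auto
  have "(P \<inter> {x. N \<bullet> x = b}) face_of P"
    by (rule face_of_Int_supporting_hyperplane_le) (use le in \<open>auto simp: P_def\<close>)
  then have face: "F face_of P"
    by (simp add: F_def Collect_conj_eq)
  have "y \<in> P" using y(1) by (simp add: P_def hull_inc)
  with y(2) have "F \<noteq> P" by (auto simp: F_def)
  then have lt: "aff_dim F < aff_dim P"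
    using face by (intro face_of_aff_dim_lt) (auto simp: P_def)
  have "int DIM('a) - 1 \<le> aff_dim T"
  proof -
    obtain \<H> where \<H>: "finite \<H>" "card \<H> + aff_dim T = DIM('a)" "affine hull T = \<Inter>\<H>"
      "\<And>h. h \<in> \<H> \<Longrightarrow> \<exists>v c. v \<noteq> 0 \<and> h = {x. v \<bullet> x = c}"
      by (rule affine_hull_finite_intersection_hyperplanes) blast
    have "h = {x. N \<bullet> x = b}" if h: "h \<in> \<H>" for h
    proof -
      obtain v c where v: "v \<noteq> 0" "h = {x. v \<bullet> x = c}" using \<H>(4)[OF h] by blast
      have "T \<subseteq> h" using \<H>(3) h hull_subset[of T affine] by blast
      then have "\<exists>t. v = t *\<^sub>R N \<and> c = t * b"
        by (intro unique) (auto simp: T_def v(2))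
      then show ?thesis using v by auto
    qed
    then have "\<H> \<subseteq> {{x. N \<bullet> x = b}}" by blast
    then have "card \<H> \<le> 1" using card_mono[of "{{x. N \<bullet> x = b}}" \<H>] by simp
    then show ?thesis using \<H>(2) by linarith
  qed
  moreover have "T \<subseteq> F" by (auto simp: T_def F_def P_def hull_inc)
  ultimately have ge: "int DIM('a) - 1 \<le> aff_dim F" using aff_dim_subset[of T F] by linarith
  moreover have "aff_dim P \<le> DIM('a)" by (rule aff_dim_le_DIM)
  ultimately have "aff_dim F = aff_dim P - 1" using lt by linarith
  moreover have "0 \<le> aff_dim F" using ge DIM_positive[where 'a='a] by linarith
  then have "F \<noteq> {}" by auto
  ultimately show "{x \<in> convex hull X. N \<bullet> x = b} facet_of convex hull X"
    using face unfolding facet_of_def F_def P_def by blast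
qed

section \<open>Points, levels and tight sets\<close>

text \<open>
  The size conditions on \<open>S m\<close> are expressed by its complement, which avoids truncated subtraction.
\<close>

locale nested_facet =
  fixes ix :: "nat \<Rightarrow> 'm::finite"
    and S :: "nat \<Rightarrow> 'n::finite set"
    and S' :: "'n set"
    and m l u p :: nat
  assumes bij: "bij_betw ix {1..m} (UNIV :: 'm set)"
    and lu: "l < u" and u2: "u \<ge> 2"
    and strict: "\<And>i. i \<in> {1..<m} \<Longrightarrow> S i \<subset> S (Suc i)"
    and S1: "card (S 1) \<ge> 2"
    and l_le: "l \<le> card (- S m)"
    and p: "p \<in> {1..m}"
    and card_p: "card (S' - S p) < u"
    and room: "p < m \<or> l < card (- S m)"
    and U1: "S p \<subseteq> S'"
    and U2: "p \<ge> 2 \<Longrightarrow> card (S' - S (p - 1)) \<ge> u"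
    and U3: "card S' > u"
    and U4: "p < m \<Longrightarrow> S' \<inter> (S (Suc p) - S p) \<noteq> {}"
begin

lemma S_mono: "1 \<le> i \<Longrightarrow> i \<le> k \<Longrightarrow> k \<le> m \<Longrightarrow> S i \<subseteq> S k"
proof (induction k)
  case (Suc k)
  then show ?case
  proof (cases "i = Suc k")
    case False
    then have "S i \<subseteq> S k" "S k \<subset> S (Suc k)" using Suc strict[of k] by auto
    then show ?thesis by blast
  qed simp
qed simp

definition idx :: "'m \<Rightarrow> nat" where
  "idx = inv_into {1..m} ix"

definition point :: "'n set \<Rightarrow> (real^'n) \<times> (real^'m)" where
  "point A = (\<chi> j. of_bool (j \<in> A), \<chi> k. of_bool (A \<inter> S (idx k) = {}))"

lemma idx_ix: "i \<in> {1..m} \<Longrightarrow> idx (ix i) = i"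
  using bij by (simp add: bij_betw_def idx_def inv_into_f_f)

lemma ix_cases:
  obtains i where "i \<in> {1..m}" "k = ix i"
  using bij unfolding bij_betw_def by (metis UNIV_I imageE)

lemma sum_over_ix: "(\<Sum>k\<in>UNIV. g k) = (\<Sum>i=1..m. g (ix i))"
  using sum.reindex_bij_betw[OF bij, of g] by simp

lemma Xset_eq: "Xset ix m S l u = point ` {A. l \<le> card A \<and> card A \<le> u}"
proof (intro equalityI subsetI)
  fix x assume "x \<in> Xset ix m S l u"
  then obtain z \<delta> where x: "x = (z, \<delta>)" and z: "\<And>j. z $ j \<in> {0, 1}"
    and \<delta>: "\<And>i. i \<in> {1..m} \<Longrightarrow> \<delta> $ ix i = (\<Prod>j\<in>S i. 1 - z $ j)"
    and card: "real l \<le> (\<Sum>j\<in>UNIV. z $ j)" "(\<Sum>j\<in>UNIV. z $ j) \<le> real u"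
    by (auto simp: Xset_def)
  define A where "A = {j. z $ j = 1}"
  have zA: "z $ j = of_bool (j \<in> A)" for j using z[of j] by (auto simp: A_def)
  have "(\<Sum>j\<in>UNIV. z $ j) = card A" by (simp add: zA)
  then have cA: "l \<le> card A" "card A \<le> u" using card by auto
  have "\<delta> $ k = of_bool (A \<inter> S (idx k) = {})" for k
  proof -
    obtain i where i: "i \<in> {1..m}" "k = ix i" by (rule ix_cases)
    have "(\<Prod>j\<in>S i. 1 - z $ j) = of_bool (A \<inter> S i = {})"
      by (auto simp: zA prod_zero_iff intro!: prod.neutral)
    then show ?thesis using \<delta>[OF i(1)] idx_ix[OF i(1)] i(2) by simp
  qed
  then have "x = point A" by (simp add: x point_def vec_eq_iff zA)
  then show "x \<in> point ` {A. l \<le> card A \<and> card A \<le> u}" using cA by blast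
next
  fix x assume "x \<in> point ` {A. l \<le> card A \<and> card A \<le> u}"
  then obtain A where A: "x = point A" "l \<le> card A" "card A \<le> u" by blast
  have "(\<Prod>j\<in>S i. 1 - (of_bool (j \<in> A) :: real)) = of_bool (A \<inter> S i = {})" for i
    by (auto simp: prod_zero_iff intro!: prod.neutral)
  then show "x \<in> Xset ix m S l u"
    using A by (auto simp: Xset_def point_def idx_ix)
qed

definition level :: "'n set \<Rightarrow> nat \<Rightarrow> bool" where
  "level A k \<longleftrightarrow> k \<le> m \<and> (\<forall>i\<in>{1..m}. A \<inter> S i = {} \<longleftrightarrow> i \<le> k)"

text \<open>By nestedness, the two members of the family next to \<open>k\<close> determine the level.\<close>

lemma levelI:
  assumes "k \<le> m" "1 \<le> k \<Longrightarrow> A \<inter> S k = {}" "k < m \<Longrightarrow> A \<inter> S (Suc k) \<noteq> {}"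
  shows "level A k"
  unfolding level_def
proof (intro conjI ballI iffI)
  fix i assume i: "i \<in> {1..m}" "A \<inter> S i = {}"
  show "i \<le> k"
  proof (rule ccontr)
    assume "\<not> i \<le> k"
    then have "k < m" "Suc k \<le> i" using i by auto
    moreover from this have "S (Suc k) \<subseteq> S i" using i by (intro S_mono) auto
    ultimately have "S (Suc k) \<subseteq> S i" "k < m" by auto
    then show False using assms(3) i by blast
  qed
next
  fix i assume i: "i \<in> {1..m}" "i \<le> k"
  then have "S i \<subseteq> S k" using assms(1) by (intro S_mono) auto
  then show "A \<inter> S i = {}" using assms(2) i by auto
qed (use assms in simp)

lemma ex_level: "\<exists>k. level A k"
proof -
  define K where "K = {k. k \<le> m \<and> (1 \<le> k \<longrightarrow> A \<inter> S k = {})}"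
  have K: "finite K" "0 \<in> K" by (auto simp: K_def)
  then have "Max K \<in> K" by (intro Max_in) auto
  moreover have "Suc (Max K) \<notin> K" using Max_ge[OF K(1), of "Suc (Max K)"] by auto
  ultimately have "level A (Max K)" by (intro levelI) (auto simp: K_def)
  then show ?thesis ..
qed

lemma inner_point:
  assumes "level A k"
  shows "(\<alpha>, \<beta>) \<bullet> point A = (\<Sum>j\<in>A. \<alpha> $ j) + (\<Sum>i=1..k. \<beta> $ ix i)"
proof -
  have "\<beta> \<bullet> snd (point A) = (\<Sum>i=1..m. \<beta> $ ix i * of_bool (A \<inter> S i = {}))"
    unfolding inner_vec_def sum_over_ix by (intro sum.cong) (auto simp: point_def idx_ix)
  also have "\<dots> = (\<Sum>i=1..m. if i \<le> k then \<beta> $ ix i else 0)"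
    using assms by (intro sum.cong) (auto simp: level_def)
  also have "\<dots> = (\<Sum>i | i \<in> {1..m} \<and> i \<le> k. \<beta> $ ix i)"
    by (rule sum.inter_filter[symmetric]) simp
  also have "{i. i \<in> {1..m} \<and> i \<le> k} = {1..k}"
    using assms by (auto simp: level_def)
  finally have "\<beta> \<bullet> snd (point A) = (\<Sum>i=1..k. \<beta> $ ix i)" .
  moreover have "\<alpha> \<bullet> fst (point A) = (\<Sum>j\<in>A. \<alpha> $ j)"
    by (simp add: inner_vec_def point_def)
  ultimately show ?thesis by (simp add: inner_prod_def)
qed

text \<open>
  The coefficients of \<open>\<delta>\<close>, extended by zero below \<open>p\<close>. They are the differences of \<open>delta_part\<close>, which
  at level \<open>k \<ge> p\<close> is what \<open>S' - S k\<close> leaves open up to \<open>u\<close>.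
\<close>

definition w :: "nat \<Rightarrow> real" where
  "w i = (if i < p then 0 else if i = p then real u - card (S' - S p)
          else real (card (S' - S (i - 1))) - card (S' - S i))"

definition delta_part :: "nat \<Rightarrow> real" where
  "delta_part k = (if k < p then 0 else real u - card (S' - S k))"

lemma sum_w: "(\<Sum>i=1..k. w i) = delta_part k"
proof (induction k)
  case 0
  then show ?case using p by (simp add: delta_part_def)
next
  case (Suc k)
  then show ?case using p by (auto simp: w_def delta_part_def)
qed

definition normal :: "(real^'n) \<times> (real^'m)" where
  "normal = (\<chi> j. of_bool (j \<in> S'), \<chi> k. w (idx k))"

lemma inner_normal:
  "normal \<bullet> (z, \<delta>) = (\<Sum>j\<in>S'. z $ j) + (real u - card (S' - S p)) * \<delta> $ ix p
     + (\<Sum>i=p+1..m. (real (card (S' - S (i - 1))) - card (S' - S i)) * \<delta> $ ix i)"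
proof -
  have "{1..m} = {1..<p} \<union> {p} \<union> {p+1..m}" using p by auto
  then have "(\<Sum>i=1..m. w i * \<delta> $ ix i) = (\<Sum>i\<in>{1..<p} \<union> {p} \<union> {p+1..m}. w i * \<delta> $ ix i)"
    by metis
  also have "\<dots> = (\<Sum>i\<in>{1..<p}. w i * \<delta> $ ix i) + w p * \<delta> $ ix p + (\<Sum>i=p+1..m. w i * \<delta> $ ix i)"
    by (subst sum.union_disjoint; auto)+
  also have "(\<Sum>i\<in>{1..<p}. w i * \<delta> $ ix i) = 0" by (simp add: w_def)
  also have "(\<Sum>i=p+1..m. w i * \<delta> $ ix i)
      = (\<Sum>i=p+1..m. (real (card (S' - S (i - 1))) - card (S' - S i)) * \<delta> $ ix i)"
    by (intro sum.cong) (auto simp: w_def)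
  finally have "(\<Sum>i=1..m. w i * \<delta> $ ix i) = (real u - card (S' - S p)) * \<delta> $ ix p
     + (\<Sum>i=p+1..m. (real (card (S' - S (i - 1))) - card (S' - S i)) * \<delta> $ ix i)"
    by (simp add: w_def)
  moreover have "snd normal \<bullet> \<delta> = (\<Sum>i=1..m. w i * \<delta> $ ix i)"
    unfolding inner_vec_def sum_over_ix by (intro sum.cong) (auto simp: normal_def idx_ix)
  moreover have "fst normal \<bullet> z = (\<Sum>j\<in>S'. z $ j)"
    by (simp add: normal_def inner_vec_def)
  ultimately show ?thesis by (simp add: inner_prod_def)
qed

lemma normal_point:
  assumes "level A k"
  shows "normal \<bullet> point A = card (A \<inter> S') + delta_part k"
proof -
  have "k \<le> m" using assms by (simp add: level_def)
  have "normal \<bullet> point A = card (A \<inter> S') + (\<Sum>i=1..k. w (idx (ix i)))"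
    unfolding normal_def inner_point[OF assms] by (simp add: Int_def)
  also have "(\<Sum>i=1..k. w (idx (ix i))) = (\<Sum>i=1..k. w i)"
    using \<open>k \<le> m\<close> by (intro sum.cong) (auto simp: idx_ix)
  finally show ?thesis by (simp only: sum_w)
qed

lemma normal_le:
  assumes "card A \<le> u"
  shows "normal \<bullet> point A \<le> u"
proof -
  obtain k where k: "level A k" using ex_level by blast
  show ?thesis
  proof (cases "k < p")
    case True
    have "card (A \<inter> S') \<le> card A" by (intro card_mono) auto
    then show ?thesis using True assms by (simp add: normal_point[OF k] delta_part_def)
  next
    case False
    then have "A \<inter> S k = {}" using k p by (auto simp: level_def)
    then have "card (A \<inter> S') \<le> card (S' - S k)" by (intro card_mono) auto
    then show ?thesis using False by (simp add: normal_point[OF k] delta_part_def)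
  qed
qed

definition tight :: "'n set \<Rightarrow> bool" where
  "tight A \<longleftrightarrow> l \<le> card A \<and> card A \<le> u \<and> normal \<bullet> point A = u"

lemma tight_below:
  assumes "level A k" "k < p" "A \<subseteq> S'" "card A = u"
  shows "tight A"
  using assms lu by (simp add: tight_def normal_point delta_part_def Int_absorb2)

lemma tight_above:
  assumes k: "level A k" "p \<le> k" and "S' - S k \<subseteq> A" "l \<le> card A" "card A \<le> u"
  shows "tight A" "A \<inter> S' = S' - S k"
proof -
  have "A \<inter> S k = {}" using k p by (auto simp: level_def)
  then show "A \<inter> S' = S' - S k" using assms(3) by blast
  then show "tight A" using assms by (simp add: tight_def normal_point[OF k(1)] delta_part_def)
qed

text \<open>
  If \<open>p < m\<close> or \<open>l < |J - S m|\<close>, then there is one element more outside \<open>S p\<close> than a set of size \<open>l\<close>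
  needs; this leaves the freedom to add or omit one.
\<close>

lemma room_p: "l < card (- S p)"
proof (cases "p < m")
  case True
  then have "S p \<subset> S m" using p strict[of p] S_mono[of "Suc p" m] by auto
  then have "card (- S m) < card (- S p)" by (intro psubset_card_mono) auto
  then show ?thesis using l_le by linarith
next
  case False
  then show ?thesis using room p by auto
qed

lemma room_above:
  assumes "1 \<le> k" "k \<le> m"
  shows "l \<le> card (- S k)"
proof -
  have "card (- S m) \<le> card (- S k)" using S_mono[of k m] assms by (intro card_mono) auto
  then show ?thesis using l_le by linarith
qed

lemma card_above: "p \<le> k \<Longrightarrow> k \<le> m \<Longrightarrow> card (S' - S k) < u"
  using S_mono[of p k] p card_mono[of "S' - S p" "S' - S k"] card_p by fastforce

text \<open>
  By \<open>S' \<inter> S (p + 1) \<noteq> S' \<inter> S p\<close>, a set that contains \<open>S' - S p\<close> and misses \<open>S p\<close> meets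
  \<open>S (p + 1)\<close>, so its level is exactly \<open>p\<close>.
\<close>

lemma tight_at_p:
  assumes "S' - S p \<subseteq> A" "A \<subseteq> - S p" "l \<le> card A" "card A \<le> u"
  shows "level A p" "tight A"
proof -
  show "level A p" using p assms U4 by (intro levelI) auto
  then show "tight A" using assms by (intro tight_above) auto
qed

lemma ex_tight_above:
  assumes "p \<le> k" "k \<le> m"
  obtains A where "level A k" "tight A" "A \<inter> S' = S' - S k"
proof -
  have k1: "1 \<le> k" using assms p by auto
  \<comment> \<open>An element of \<open>S (k + 1)\<close> prevents a level above \<open>k\<close>. It costs at most one element, which fits
    because \<open>|S' - S k| < u\<close>.\<close>
  obtain E where E: "k < m \<Longrightarrow> E \<inter> S (Suc k) \<noteq> {}" "E \<subseteq> - S k" "card E \<le> 1"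
  proof (cases "k < m")
    case True
    then obtain t where "t \<in> S (Suc k)" "t \<notin> S k" using strict[of k] k1 by auto
    then show thesis by (intro that[of "{t}"]) auto
  qed (auto intro: that[of "{}"])
  define B where "B = (S' - S k) \<union> E"
  have "card B \<le> card (S' - S k) + card E" unfolding B_def by (rule card_Un_le)
  then have Bu: "card B \<le> u" using card_above[OF assms] E(3) by linarith
  have Bk: "B \<subseteq> - S k" using E(2) by (auto simp: B_def)
  then have "card B \<le> card (- S k)" by (intro card_mono) auto
  then obtain A where A: "B \<subseteq> A" "A \<subseteq> - S k" "card A = max (card B) l"
    using exists_subset_between[of B "max (card B) l" "- S k"] Bk room_above[OF k1 assms(2)] by auto
  have lev: "level A k"
    using A E(1) assms by (intro levelI) (auto simp: B_def)
  have A': "S' - S k \<subseteq> A" "l \<le> card A" "card A \<le> u" using A Bu lu by (auto simp: B_def)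
  show thesis
    using that[OF lev] tight_above[OF lev assms(1) A'] by blast
qed

section \<open>Uniqueness of the equation\<close>

context
  fixes \<alpha> :: "real^'n" and \<beta> :: "real^'m" and c :: real
  assumes eq: "\<And>A. tight A \<Longrightarrow> (\<alpha>, \<beta>) \<bullet> point A = c"
begin

lemma eq_level: "tight A \<Longrightarrow> level A k \<Longrightarrow> (\<Sum>j\<in>A. \<alpha> $ j) + (\<Sum>i=1..k. \<beta> $ ix i) = c"
  using eq inner_point by metis

lemma S1_subset: "S 1 \<subseteq> S'"
  using S_mono[of 1 p] p U1 by auto

text \<open>
  A subset of \<open>S'\<close> that contains an element \<open>s\<close> of \<open>S 1\<close> has level \<open>0\<close>, whatever its other elements
  are, so any two elements of \<open>S' - {s}\<close> can be exchanged.
\<close>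

lemma level_0_tight:
  assumes "s \<in> S 1" "s \<in> A" "A \<subseteq> S'" "card A = u"
  shows "(\<Sum>j\<in>A. \<alpha> $ j) = c"
proof -
  have "level A 0" using assms by (intro levelI) auto
  moreover from this have "tight A" using assms p by (intro tight_below) auto
  ultimately show ?thesis using eq_level by fastforce
qed

lemma exchange:
  assumes s: "s \<in> S 1" and ij: "i \<in> S' - {s}" "j \<in> S' - {s}"
  shows "\<alpha> $ i = \<alpha> $ j"
proof (cases "i = j")
  case False
  have "s \<in> S'" using s S1_subset by blast
  then have "card {s, i, j} = 3" "card (S' - {i, j}) = card S' - 2"
    using False ij by (auto simp: card_Diff_subset)
  then have "\<exists>C. {s} \<subseteq> C \<and> C \<subseteq> S' - {i, j} \<and> card C = u - 1"
    using \<open>s \<in> S'\<close> ij U3 u2 by (intro exists_subset_between) auto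
  then obtain C where C: "s \<in> C" "C \<subseteq> S' - {i, j}" "card C = u - 1" by auto
  have notin: "i \<notin> C" "j \<notin> C" using C by auto
  have "(\<Sum>j\<in>insert x C. \<alpha> $ j) = c" if "x = i \<or> x = j" for x
    using s C notin ij u2 that by (intro level_0_tight[of s]) auto
  then have "(\<Sum>j\<in>insert i C. \<alpha> $ j) = (\<Sum>j\<in>insert j C. \<alpha> $ j)" by metis
  then show ?thesis using notin by simp
qed simp

lemma alpha_const:
  obtains a where "\<And>j. j \<in> S' \<Longrightarrow> \<alpha> $ j = a" "c = a * u"
proof -
  \<comment> \<open>The exchange with \<open>s\<close> fixed leaves out \<open>s\<close> itself. A second element \<open>t\<close> of \<open>S 1\<close> covers it,
    and the common reference \<open>r\<close> exists because \<open>|S'| \<ge> 3\<close>.\<close>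
  obtain T where "T \<subseteq> S 1" "card T = 2" using obtain_subset_with_card_n[OF S1] by blast
  then obtain s t where st: "s \<in> S 1" "t \<in> S 1" "s \<noteq> t"
    by (auto simp: card_2_iff)
  have "\<not> S' \<subseteq> {s, t}"
    using U3 u2 card_mono[of "{s, t}" S'] st by auto
  then obtain r where r: "r \<in> S' - {s, t}" by blast
  have const: "\<alpha> $ j = \<alpha> $ r" if "j \<in> S'" for j
    using exchange[of s j r] exchange[of t j r] st r that by (cases "j = s") auto
  have "\<exists>A. {s} \<subseteq> A \<and> A \<subseteq> S' \<and> card A = u"
    using st S1_subset U3 u2 by (intro exists_subset_between) auto
  then obtain A where A: "s \<in> A" "A \<subseteq> S'" "card A = u" by auto
  have "c = (\<Sum>j\<in>A. \<alpha> $ j)" using level_0_tight[OF st(1) A] by simp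
  also have "\<dots> = (\<Sum>j\<in>A. \<alpha> $ r)" using const A by (intro sum.cong) auto
  finally show thesis using that[OF const] A by (simp add: mult.commute)
qed

text \<open>
  Both \<open>A\<close> and \<open>A \<union> {j}\<close> are tight of level \<open>p\<close>, for an \<open>A\<close> between \<open>S' - S p\<close> and
  \<open>- S p - {j}\<close> whose size is at least \<open>l\<close> and less than \<open>u\<close>; here \<open>S p \<subseteq> S'\<close> ensures \<open>j \<notin> S p\<close>.
\<close>

lemma alpha_zero:
  assumes j: "j \<notin> S'"
  shows "\<alpha> $ j = 0"
proof -
  have jp: "j \<in> - S p" using j U1 by auto
  then have "card (- S p - {j}) = card (- S p) - 1" by simp
  then have "l \<le> card (- S p - {j})" using room_p by linarith
  moreover have sub: "S' - S p \<subseteq> - S p - {j}" using j by auto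
  then have "card (S' - S p) \<le> card (- S p - {j})" by (intro card_mono) auto
  ultimately have "\<exists>A. S' - S p \<subseteq> A \<and> A \<subseteq> - S p - {j} \<and> card A = max (card (S' - S p)) l"
    using sub by (intro exists_subset_between) auto
  then obtain A where A: "S' - S p \<subseteq> A" "A \<subseteq> - S p - {j}" "card A = max (card (S' - S p)) l"
    by blast
  have "card A < u" using A card_p lu by auto
  moreover have "j \<notin> A" using A by auto
  ultimately have "level A p" "tight A" "level (insert j A) p" "tight (insert j A)"
    using A jp by (auto intro!: tight_at_p)
  then show ?thesis using eq_level[of A p] eq_level[of "insert j A" p] \<open>j \<notin> A\<close> by simp
qed

text \<open>
  For levels below \<open>p\<close>, the set has to be found within \<open>S' - S k\<close>. This is large enough because
  already \<open>S' - S (p - 1)\<close> has \<open>u\<close> elements.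
\<close>

lemma ex_tight_below:
  assumes "1 \<le> k" "k < p"
  obtains A where "level A k" "tight A" "A \<subseteq> S'" "card A = u"
proof -
  obtain t where t: "t \<in> S (Suc k)" "t \<notin> S k" using strict[of k] assms p by auto
  have "t \<in> S'" using t S_mono[of "Suc k" p] assms p U1 by auto
  have "S k \<subseteq> S (p - 1)" using assms p by (intro S_mono) auto
  then have "card (S' - S (p - 1)) \<le> card (S' - S k)" by (intro card_mono) auto
  moreover have "u \<le> card (S' - S (p - 1))" using assms by (intro U2) auto
  ultimately have "\<exists>A. {t} \<subseteq> A \<and> A \<subseteq> S' - S k \<and> card A = u"
    using t \<open>t \<in> S'\<close> u2 by (intro exists_subset_between) auto
  then obtain A where A: "t \<in> A" "A \<subseteq> S' - S k" "card A = u" by auto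
  have "level A k" using A t assms p by (intro levelI) auto
  then show thesis using A assms that tight_below[of A k] by blast
qed

lemma eq_multiple: "\<exists>a. (\<alpha>, \<beta>) = a *\<^sub>R normal \<and> c = a * u"
proof -
  obtain a where a: "\<And>j. j \<in> S' \<Longrightarrow> \<alpha> $ j = a" "c = a * u" using alpha_const by blast
  have \<alpha>: "\<alpha> $ j = a * of_bool (j \<in> S')" for j using a alpha_zero by auto
  then have sum_\<alpha>: "(\<Sum>j\<in>A. \<alpha> $ j) = a * card (A \<inter> S')" for A
    by (simp add: sum_distrib_left[symmetric] Int_def)
  have partial: "(\<Sum>i=1..k. \<beta> $ ix i) = a * delta_part k" if k: "k \<le> m" for k
  proof -
    consider "k = 0" | "1 \<le> k" "k < p" | "p \<le> k" by linarith
    then show ?thesis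
    proof cases
      case 1
      then show ?thesis using p by (simp add: delta_part_def)
    next
      case 2
      then obtain A where A: "level A k" "tight A" "A \<subseteq> S'" "card A = u"
        by (rule ex_tight_below)
      then show ?thesis
        using eq_level[of A k] 2 a by (simp add: sum_\<alpha> Int_absorb2 delta_part_def)
    next
      case 3
      then obtain A where A: "level A k" "tight A" "A \<inter> S' = S' - S k"
        using k by (rule ex_tight_above)
      then show ?thesis
        using eq_level[of A k] 3 a by (simp add: sum_\<alpha> delta_part_def algebra_simps)
    qed
  qed
  have "\<beta> $ ix i = a * w i" if i: "i \<in> {1..m}" for i
  proof -
    obtain k where k: "i = Suc k" using i by (cases i) auto
    have "(\<Sum>i=1..Suc k. \<beta> $ ix i) = a * (\<Sum>i=1..Suc k. w i)" "(\<Sum>i=1..k. \<beta> $ ix i) = a * (\<Sum>i=1..k. w i)"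
      using partial[of "Suc k"] partial[of k] i k unfolding sum_w by auto
    then show ?thesis by (simp add: k algebra_simps)
  qed
  then have "\<beta> $ k = a * w (idx k)" for k
    using ix_cases[of k] idx_ix by metis
  then have "(\<alpha>, \<beta>) = a *\<^sub>R normal" by (simp add: normal_def vec_eq_iff \<alpha>)
  then show ?thesis using a by blast
qed

end

text \<open>
  A set of size \<open>max l 1 < u\<close> that meets \<open>S 1\<close> has level \<open>0\<close>, so all \<open>\<delta>\<close> vanish there and the
  left-hand side is less than \<open>u\<close>.
\<close>

lemma slack_point: "\<exists>A. l \<le> card A \<and> card A \<le> u \<and> normal \<bullet> point A < u"
proof -
  obtain s where s: "s \<in> S 1" using S1 by fastforce
  have "card S' \<le> CARD('n)" by (intro card_mono) auto
  then have "\<exists>A. {s} \<subseteq> A \<and> A \<subseteq> UNIV \<and> card A = max l 1"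
    using lu U3 u2 by (intro exists_subset_between) auto
  then obtain A where A: "s \<in> A" "card A = max l 1" by auto
  have "level A 0" using A s by (intro levelI) auto
  moreover have "card (A \<inter> S') \<le> card A" by (intro card_mono) auto
  ultimately have "normal \<bullet> point A < u"
    using A p lu u2 by (simp add: normal_point delta_part_def)
  then show ?thesis using A lu u2 by (intro exI[of _ A]) auto
qed

lemma facet: "defines_facet (\<lambda>x. normal \<bullet> x) u (convex hull (Xset ix m S l u))"
proof -
  obtain A where A: "l \<le> card A" "card A \<le> u" "normal \<bullet> point A < u" using slack_point by blast
  have unique: "\<exists>t. v = t *\<^sub>R normal \<and> c = t * u"
    if v: "\<And>x. x \<in> Xset ix m S l u \<Longrightarrow> normal \<bullet> x = u \<Longrightarrow> v \<bullet> x = c" for v c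
  proof (cases v)
    case (Pair \<alpha> \<beta>)
    have "(\<alpha>, \<beta>) \<bullet> point A = c" if "tight A" for A
      using v that by (auto simp: Xset_eq tight_def Pair)
    then show ?thesis unfolding Pair by (rule eq_multiple)
  qed
  have "\<And>x. x \<in> Xset ix m S l u \<Longrightarrow> normal \<bullet> x \<le> u"
    by (auto simp: Xset_eq normal_le)
  moreover have "point A \<in> Xset ix m S l u" using A by (auto simp: Xset_eq)
  ultimately have "\<forall>x\<in>convex hull (Xset ix m S l u). normal \<bullet> x \<le> u"
    "{x \<in> convex hull (Xset ix m S l u). normal \<bullet> x = u} facet_of convex hull (Xset ix m S l u)"
    using facet_of_convex_hullI[of "Xset ix m S l u" normal "real u" "point A"] A(3) unique by blast+
  then show ?thesis
    unfolding defines_facet_def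
    using bounded_linear_inner_right[of normal] bounded_linear.linear by blast
qed

end

section \<open>The facet theorem\<close>

theorem theorem15:
  fixes ix :: "nat \<Rightarrow> 'm::finite"
    and S :: "nat \<Rightarrow> 'n::finite set"
    and S' :: "'n set"
    and n m l u p :: nat
  assumes "n = CARD('n)"
    and "m \<ge> 1" and "bij_betw ix {1..m} (UNIV :: 'm set)"
    and "l < u" and "u \<ge> 2"
    and "\<forall>i\<in>{1..<m}. S i \<subset> S (i + 1)"
    and "S m \<subset> UNIV"
    and "card (S 1) \<ge> 2"
    and "l \<le> n - card (S m)"
    and "p \<in> {1..m}"
    and "card (S' - S p) \<le> u - 1"
    and "p < m \<or> card (S m) < n - l"
    and U1: "S' \<supseteq> S p"
    and U2: "p \<ge> 2 \<longrightarrow> card (S' - S (p - 1)) \<ge> u"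
    and U3: "card S' \<ge> u + 1"
    and U4: "p \<le> m - 1 \<longrightarrow> S' \<inter> (S (p + 1) - S p) \<noteq> {}"
  shows "defines_facet
    (\<lambda>(z :: real^'n, \<delta> :: real^'m).
        (\<Sum>j\<in>S'. z $ j)
        + (real u - real (card (S' - S p))) * \<delta> $ ix p
        + (\<Sum>i=p+1..m. (real (card (S' - S (i - 1))) - real (card (S' - S i))) * \<delta> $ ix i))
    (real u)
    (convex hull (Xset ix m S l u))"
proof -
  have card_Compl: "card (- S m) = n - card (S m)"
    using assms(1) by (simp add: Compl_eq_Diff_UNIV card_Diff_subset)
  interpret nested_facet ix S S' m l u p
    by unfold_locales (use assms card_Compl in auto)
  have "(\<lambda>(z, \<delta>). (\<Sum>j\<in>S'. z $ j) + (real u - card (S' - S p)) * \<delta> $ ix p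
      + (\<Sum>i=p+1..m. (real (card (S' - S (i - 1))) - card (S' - S i)) * \<delta> $ ix i))
    = (\<lambda>x. normal \<bullet> x)"
    by (rule ext) (simp only: split_paired_all prod.case inner_normal)
  then show ?thesis using facet by (simp only:)
qed

end
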